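(* Let $(G,M,\Phi)$ be a metrically invariant transformation group and let $m\in M$. If $M$ is compact then every $G$-valued càdlàg Lévy process is recurrent at $m$.
   Context: A transformation group $(G,M,\Phi)$ consists of a topological group $G$ with neutral element $e$, a topological space $M$ and a continuous map $\Phi:G\times M\to M$ with $\Phi(e,m)=m$ and $\Phi(\sigma,\Phi(\tau,m))=\Phi(\sigma\tau,m)$ for all $\sigma,\tau\in G$, $m\in M$. Put $\Phi_m:=\Phi(\cdot,m):G\to M$. It is metrically invariant if the topology of $M$ is metrisable by a complete metric $d$ satisfying $d(\Phi(\sigma,m_1),\Phi(\sigma,m_2))=d(m_1,m_2)$ for all $m_1,m_2\in M$, $\sigma\in G$; such a $d$ is fixed. A Lévy process in $G$ is a $G$-valued stochastic process $Z=(Z(t),t\ge0)$ on a probability space $(\Omega,\mathcal F,P)$ such that: (i) $Z$ has stationary and independent left increments $Z(s)^{-1}Z(t)$, $s\le t$; (ii) $Z(0)=e$ a.s.; (iii) $\lim_{s\downarrow t}P(Z(s)^{-1}Z(t)\in A)=0$ for all Borel $A\subseteq G$ with $e\notin\bar A$ and all $t\ge0$. It is càdlàg if its paths are a.s. right continuous with left limits. For $m\in M$, put $Z^{\Phi,m}(t)=\Phi_m(Z(t))$. $Z$ is recurrent at $m$ if $\liminf_{t\to\infty}d(Z^{\Phi,m}(t),m)=0$ a.s. *)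

theory Defs
  imports "HOL-Probability.Probability"
begin

text \<open>
  The group is written additively, because the library's class of topological groups
  \<^class>\<open>topological_group_add\<close> is additive. This class does not assume commutativity
  (it extends \<^class>\<open>group_add\<close>): the neutral element \<open>e\<close> is \<open>0\<close>, the product \<open>\<sigma>\<tau>\<close> is \<open>\<sigma> + \<tau>\<close>, and
  the left increment \<open>Z(s)\<inverse>Z(t)\<close> is \<open>- Z s + Z t\<close>, in this order.
\<close>

locale transformation_group =
  fixes \<Phi> :: "'g::topological_group_add \<Rightarrow> 'm::topological_space \<Rightarrow> 'm"
  assumes continuous_action: "continuous_on UNIV (\<lambda>(\<sigma>, x). \<Phi> \<sigma> x)"
    and action_zero: "\<Phi> 0 x = x"
    and action_add: "\<Phi> \<sigma> (\<Phi> \<tau> x) = \<Phi> (\<sigma> + \<tau>) x"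

text \<open>
  The complete invariant metric \<open>d\<close> that metrises the given topology of the phase space is an
  explicit parameter, since recurrence refers to the fixed metric.
\<close>

locale metrically_invariant_transformation_group =
  transformation_group \<Phi> + Metric_space "UNIV :: 'm set" d
  for \<Phi> :: "'g::topological_group_add \<Rightarrow> 'm::topological_space \<Rightarrow> 'm"
    and d :: "'m \<Rightarrow> 'm \<Rightarrow> real" +
  assumes metrises: "mtopology = euclidean"
    and complete: "mcomplete"
    and invariant: "d (\<Phi> \<sigma> x) (\<Phi> \<sigma> y) = d x y"

definition left_increment :: "(real \<Rightarrow> 'w \<Rightarrow> 'g::group_add) \<Rightarrow> real \<Rightarrow> real \<Rightarrow> 'w \<Rightarrow> 'g" where
  "left_increment Z s t \<omega> = - Z s \<omega> + Z t \<omega>"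

text \<open>
  Time is \<^typ>\<open>real\<close>, and only the values \<open>Z t\<close> with \<open>t \<ge> 0\<close> are constrained. The requirement that
  the increments be random variables is part of \<^const>\<open>prob_space.indep_vars\<close> (take \<open>n = 1\<close>);
  it does not follow from measurability of \<open>Z s\<close> and \<open>Z t\<close> if the group is not second countable.
\<close>

locale levy_process = prob_space P
  for P :: "'w measure" and Z :: "real \<Rightarrow> 'w \<Rightarrow> 'g::topological_group_add" +
  assumes process: "t \<ge> 0 \<Longrightarrow> random_variable borel (Z t)"
    and stationary_increments: "s \<ge> 0 \<Longrightarrow> t \<ge> 0 \<Longrightarrow> h \<ge> 0 \<Longrightarrow>
      distr P borel (left_increment Z s (s + h)) = distr P borel (left_increment Z t (t + h))"
    and independent_increments: "\<And>(n::nat) (u::nat \<Rightarrow> real).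
      u 0 \<ge> 0 \<Longrightarrow> (\<And>i. i < n \<Longrightarrow> u i \<le> u (Suc i)) \<Longrightarrow>
      indep_vars (\<lambda>_. borel) (\<lambda>i. left_increment Z (u i) (u (Suc i))) {..<n}"
    and start: "AE \<omega> in P. Z 0 \<omega> = 0"
    and stochastic_continuity: "t \<ge> 0 \<Longrightarrow> A \<in> sets borel \<Longrightarrow> 0 \<notin> closure A \<Longrightarrow>
      ((\<lambda>s. prob {\<omega> \<in> space P. left_increment Z s t \<omega> \<in> A}) \<longlongrightarrow> 0) (at_right t)"

definition cadlag :: "(real \<Rightarrow> 'g::topological_space) \<Rightarrow> bool" where
  "cadlag f \<longleftrightarrow> (\<forall>t\<ge>0. (f \<longlongrightarrow> f t) (at_right t)) \<and> (\<forall>t>0. \<exists>l. (f \<longlongrightarrow> l) (at_left t))"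

locale cadlag_levy_process = levy_process +
  assumes cadlag_paths: "AE \<omega> in P. cadlag (\<lambda>t. Z t \<omega>)"

definition induced_process ::
  "('g \<Rightarrow> 'm \<Rightarrow> 'm) \<Rightarrow> (real \<Rightarrow> 'w \<Rightarrow> 'g) \<Rightarrow> 'm \<Rightarrow> real \<Rightarrow> 'w \<Rightarrow> 'm" where
  "induced_process \<Phi> Z m t \<omega> = \<Phi> (Z t \<omega>) m"

definition recurrent_at ::
  "'w measure \<Rightarrow> ('g \<Rightarrow> 'm \<Rightarrow> 'm) \<Rightarrow> ('m \<Rightarrow> 'm \<Rightarrow> real) \<Rightarrow> (real \<Rightarrow> 'w \<Rightarrow> 'g) \<Rightarrow> 'm \<Rightarrow> bool" where
  "recurrent_at P \<Phi> d Z m \<longleftrightarrow>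
    (AE \<omega> in P. Liminf at_top (\<lambda>t. ereal (d (induced_process \<Phi> Z m t \<omega>) m)) = 0)"

end

theory Submission
  imports Defs
begin

text \<open>
  It suffices to look at integer times. Write \<open>S\<^sub>n\<close> for \<open>Z n\<close> and let \<open>X\<^sub>i\<close> be the increment from
  time \<open>i\<close> to time \<open>i + 1\<close>. By invariance of the metric, the distance between the points \<open>S\<^sub>k m\<close> and
  \<open>S\<^bsub>k+n\<^esub> m\<close> of the orbit equals the distance between \<open>m\<close> and \<open>X\<^sub>k X\<^bsub>k+1\<^esub> \<cdots> X\<^bsub>k+n-1\<^esub> m\<close>.
  Fix \<open>\<epsilon> > 0\<close> and \<open>L \<ge> 1\<close>, and let \<open>R\<^sub>k\<close> be the event that \<open>S\<^bsub>k+n\<^esub> m\<close> has distance at least \<open>\<epsilon>\<close> from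
  \<open>S\<^sub>k m\<close> for all \<open>n \<ge> L\<close>. Two facts about these events are in conflict unless they are null.

  \<^item> All \<open>R\<^sub>k\<close> have the same probability \<open>p\<close>, because \<open>R\<^sub>k\<close> depends only on the sequence
    \<open>X\<^sub>k, X\<^bsub>k+1\<^esub>, \<dots>\<close>, which is independent and identically distributed
    (\<open>distr_unit_increments_shift\<close>).
  \<^item> At every sample point, only boundedly many of \<open>R\<^sub>0, R\<^sub>L, R\<^bsub>2L\<^esub>, \<dots>\<close> occur, because the
    corresponding points of the orbit are \<open>\<epsilon>\<close>-separated and \<open>M\<close> is totally bounded
    (\<open>card_separated_bounded\<close>).

  If at most \<open>N\<close> of the events occur, then taking expectations of the number of those that occur
  among the first \<open>J\<close> gives \<open>J p \<le> N\<close> for every \<open>J\<close>, so \<open>p = 0\<close>. Applying this to \<open>R\<^sub>0\<close>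
  for all \<open>L\<close> and all \<open>\<epsilon>\<close> of the form \<open>1 / (r + 1)\<close> gives recurrence.

  The group need not be second countable, so that the product of two group-valued random variables
  need not be measurable for the product \<open>\<sigma>\<close>-algebra. The events \<open>R\<^sub>k\<close> are nevertheless measurable
  in the sequence of increments, because the group acts by isometries on a separable space: the
  iterated action can be approximated through a countable dense set (\<open>measurable_dist_action\<close>).
\<close>

section \<open>Counting equiprobable events\<close>

text \<open>
  The mean number of events that occur among the first \<open>J\<close> is \<open>J p\<close>, whatever their dependence.
\<close>

lemma (in prob_space) prob_zero_if_boundedly_many_occur:
  fixes R :: "nat \<Rightarrow> 'a set"
  assumes R: "\<And>j. R j \<in> events"
    and p: "\<And>j. prob (R j) = p"
    and bounded: "\<And>\<omega> J. \<omega> \<in> space M \<Longrightarrow> finite J \<Longrightarrow> (\<And>j. j \<in> J \<Longrightarrow> \<omega> \<in> R j) \<Longrightarrow> card J \<le> N"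
  shows "p = 0"
proof (rule ccontr)
  assume "p \<noteq> 0"
  then have "p > 0"
    using p[of 0] by (metis measure_nonneg order_le_less)
  have J: "real J * p \<le> real N" for J
  proof -
    have "real J * p = (\<Sum>j<J. prob (R j))"
      by (simp add: p)
    also have "\<dots> = (\<Sum>j<J. expectation (indicator (R j)))"
      using R by (simp add: Int_absorb2 sets.sets_into_space)
    also have "\<dots> = expectation (\<lambda>\<omega>. \<Sum>j<J. indicator (R j) \<omega>)"
      using R by (intro Bochner_Integration.integral_sum[symmetric]) (simp add: emeasure_eq_measure)
    also have "\<dots> \<le> expectation (\<lambda>\<omega>. real N)"
    proof (rule integral_mono)
      show "integrable M (\<lambda>\<omega>. \<Sum>j<J. indicator (R j) \<omega> :: real)"
        using R by (intro Bochner_Integration.integrable_sum) (simp add: emeasure_eq_measure)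
      fix \<omega> assume \<omega>: "\<omega> \<in> space M"
      have "(\<Sum>j<J. indicator (R j) \<omega>) = real (card {j\<in>{..<J}. \<omega> \<in> R j})"
        by (simp add: indicator_def sum.If_cases Int_def)
      also have "\<dots> \<le> real N"
        unfolding of_nat_le_iff by (rule bounded[OF \<omega>]) auto
      finally show "(\<Sum>j<J. indicator (R j) \<omega>) \<le> real N" .
    qed simp
    finally show ?thesis
      by (simp add: prob_space)
  qed
  obtain n where "real n * p > real N"
    using reals_Archimedean3[OF \<open>p > 0\<close>] by metis
  with J[of n] show False
    by linarith
qed

section \<open>The sequence of unit increments of a Levy process\<close>

definition unit_increments :: "(real \<Rightarrow> 'w \<Rightarrow> 'g::group_add) \<Rightarrow> nat \<Rightarrow> 'w \<Rightarrow> nat \<Rightarrow> 'g" where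
  "unit_increments Z k \<omega> i = left_increment Z (real (k + i)) (real (k + i) + 1) \<omega>"

context levy_process
begin

lemma indep_unit_increments:
  "indep_vars (\<lambda>_. borel) (\<lambda>i \<omega>. unit_increments Z k \<omega> i) UNIV"
proof -
  have eq: "(\<lambda>i \<omega>. unit_increments Z k \<omega> i) =
      (\<lambda>i. left_increment Z (real (k + i)) (real (k + Suc i)))"
    by (simp add: fun_eq_iff unit_increments_def add.commute add.left_commute)
  have n: "indep_vars (\<lambda>_. borel) (\<lambda>i \<omega>. unit_increments Z k \<omega> i) {..<n}" for n
    unfolding eq by (rule independent_increments) auto
  show ?thesis
    unfolding indep_vars_def2
  proof (intro conjI ballI)
    fix i
    show "random_variable borel (\<lambda>\<omega>. unit_increments Z k \<omega> i)"
      using n[of "Suc i"] by (auto simp: indep_vars_def2)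
  next
    \<comment> \<open>Independence of an infinite family concerns its finite subfamilies only.\<close>
    show "indep_sets (\<lambda>i. {(\<lambda>\<omega>. unit_increments Z k \<omega> i) -` A \<inter> space P |A. A \<in> sets borel}) UNIV"
      unfolding indep_sets_finite_index_sets[of _ UNIV]
    proof (intro allI impI)
      fix J :: "nat set" assume "finite J"
      then obtain b where "J \<subseteq> {..<b}"
        by (metis finite_nat_iff_bounded)
      then show "indep_sets (\<lambda>i. {(\<lambda>\<omega>. unit_increments Z k \<omega> i) -` A \<inter> space P |A. A \<in> sets borel}) J"
        using n[of b] unfolding indep_vars_def2 by (blast intro: indep_sets_mono_index)
    qed
  qed
qed

lemma measurable_unit_increment [measurable]:
  "random_variable borel (\<lambda>\<omega>. unit_increments Z k \<omega> i)"
  using indep_unit_increments[of k] by (auto simp: indep_vars_def2)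

lemma measurable_unit_increments:
  "random_variable (\<Pi>\<^sub>M i\<in>UNIV. borel) (unit_increments Z k)"
proof -
  have "(\<lambda>\<omega>. \<lambda>i\<in>UNIV. unit_increments Z k \<omega> i) \<in> P \<rightarrow>\<^sub>M (\<Pi>\<^sub>M i\<in>UNIV. borel)"
    by (rule measurable_restrict) simp
  then show ?thesis
    by (simp add: restrict_def)
qed

text \<open>
  The one-dimensional laws of the increments agree by stationarity, and an independent sequence
  has the product of its one-dimensional laws as joint law.
\<close>

lemma distr_unit_increments_shift:
  "distr P (\<Pi>\<^sub>M i\<in>UNIV. borel) (unit_increments Z k) =
   distr P (\<Pi>\<^sub>M i\<in>UNIV. borel) (unit_increments Z 0)"
proof -
  have joint: "distr P (\<Pi>\<^sub>M i\<in>UNIV. borel) (unit_increments Z k) =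
      (\<Pi>\<^sub>M i\<in>UNIV. distr P borel (\<lambda>\<omega>. unit_increments Z k \<omega> i))" for k
    using indep_unit_increments[of k]
    by (subst (asm) indep_vars_iff_distr_eq_PiM) (auto simp: restrict_def)
  have "distr P borel (\<lambda>\<omega>. unit_increments Z k \<omega> i) = distr P borel (\<lambda>\<omega>. unit_increments Z 0 \<omega> i)"
    for i
    using stationary_increments[of "real (k + i)" "real i" 1]
    by (simp add: unit_increments_def)
  then show ?thesis
    by (simp only: joint)
qed

end

section \<open>Iterated isometric action\<close>

primrec iterated_action :: "('g \<Rightarrow> 'm \<Rightarrow> 'm) \<Rightarrow> 'm \<Rightarrow> nat \<Rightarrow> (nat \<Rightarrow> 'g) \<Rightarrow> 'm" where
  "iterated_action \<Phi> p 0 x = p"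
| "iterated_action \<Phi> p (Suc n) x = \<Phi> (x 0) (iterated_action \<Phi> p n (\<lambda>i. x (Suc i)))"

context metrically_invariant_transformation_group
begin

text \<open>The product of increments telescopes.\<close>

lemma action_process_eq_iterated_action:
  "\<Phi> (Z (real (k + n)) \<omega>) p = \<Phi> (Z (real k) \<omega>) (iterated_action \<Phi> p n (unit_increments Z k \<omega>))"
proof (induction n arbitrary: k)
  case (Suc n)
  have shift: "(\<lambda>i. unit_increments Z k \<omega> (Suc i)) = unit_increments Z (Suc k) \<omega>"
    by (simp add: fun_eq_iff unit_increments_def add_ac)
  have "\<Phi> (Z (real (k + Suc n)) \<omega>) p = \<Phi> (Z (real (Suc k + n)) \<omega>) p"
    by simp
  also have "\<dots> = \<Phi> (Z (real (Suc k)) \<omega>) (iterated_action \<Phi> p n (unit_increments Z (Suc k) \<omega>))"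
    by (rule Suc.IH)
  also have "Z (real (Suc k)) \<omega> = Z (real k) \<omega> + unit_increments Z k \<omega> 0"
    by (simp add: unit_increments_def left_increment_def add.assoc[symmetric] add.commute[of 1])
  finally show ?case
    by (simp add: action_add shift)
qed simp

lemma dist_process_eq:
  "d (\<Phi> (Z (real (k + n)) \<omega>) p) (\<Phi> (Z (real k) \<omega>) p) =
   d (iterated_action \<Phi> p n (unit_increments Z k \<omega>)) p"
  by (simp only: action_process_eq_iterated_action invariant)

context
  assumes compact_space: "compact (UNIV :: 'm set)"
begin

lemma finite_net:
  assumes "e > 0"
  obtains C where "finite C" "\<And>x. \<exists>c\<in>C. d c x < e"
proof -
  have "mtotally_bounded UNIV"
    using compact_space by (intro compactin_imp_mtotally_bounded) (simp add: metrises)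
  with assms obtain C where "finite C" "UNIV \<subseteq> (\<Union>x\<in>C. mball x e)"
    unfolding mtotally_bounded_def by blast
  then show thesis
    by (intro that[of C]) (auto simp: subset_iff)
qed

text \<open>
  Pigeonhole: two points that share a centre of a net of mesh \<open>e / 2\<close> are at distance less
  than \<open>e\<close>.
\<close>

lemma card_separated_bounded:
  assumes "e > 0"
  obtains N where "\<And>(y :: nat \<Rightarrow> 'm) J. finite J \<Longrightarrow>
    (\<And>i j. i \<in> J \<Longrightarrow> j \<in> J \<Longrightarrow> i < j \<Longrightarrow> e \<le> d (y j) (y i)) \<Longrightarrow> card J \<le> N"
proof -
  obtain C where C: "finite C" "\<And>x. \<exists>c\<in>C. d c x < e / 2"
    using finite_net[of "e / 2"] assms by auto
  then obtain c where c: "\<And>x. c x \<in> C" "\<And>x. d (c x) x < e / 2"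
    by metis
  show thesis
  proof (rule that)
    fix y :: "nat \<Rightarrow> 'm" and J
    assume J: "finite J" "\<And>i j. i \<in> J \<Longrightarrow> j \<in> J \<Longrightarrow> i < j \<Longrightarrow> e \<le> d (y j) (y i)"
    have ne: "c (y i) \<noteq> c (y j)" if "i \<in> J" "j \<in> J" "i < j" for i j
    proof
      assume eq: "c (y i) = c (y j)"
      have "d (y j) (y i) \<le> d (c (y j)) (y j) + d (c (y j)) (y i)"
        using triangle[of "y j" "c (y j)" "y i"] commute by simp
      also have "\<dots> < e"
        using c(2)[of "y j"] c(2)[of "y i"] eq by simp
      finally show False
        using J(2)[OF that] by simp
    qed
    have "inj_on (c \<circ> y) J"
      by (rule inj_onI) (metis ne comp_apply linorder_neqE_nat)
    then show "card J \<le> card C"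
      by (rule card_inj_on_le) (use c C in auto)
  qed
qed

lemma countable_dense:
  obtains D where "countable D" "\<And>x e. e > 0 \<Longrightarrow> \<exists>c\<in>D. d c x < e"
proof -
  have "\<exists>C. finite C \<and> (\<forall>x. \<exists>c\<in>C. d c x < 1 / real (Suc n))" for n
    using finite_net[of "1 / real (Suc n)"]
    by (metis of_nat_0_less_iff zero_less_Suc zero_less_divide_1_iff)
  then obtain C where C: "\<And>n. finite (C n)" "\<And>n x. \<exists>c\<in>C n. d c x < 1 / real (Suc n)"
    by metis
  show thesis
  proof (rule that[of "\<Union>n. C n"])
    show "countable (\<Union>n. C n)"
      using C(1) by (intro countable_UN) (auto simp: countable_finite)
    fix x and e :: real assume "e > 0"
    then obtain n where "1 / real (Suc n) < e"
      using nat_approx_posE by blast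
    moreover obtain c where "c \<in> C n" "d c x < 1 / real (Suc n)"
      using C(2) by blast
    ultimately show "\<exists>c\<in>(\<Union>n. C n). d c x < e"
      by (intro bexI[of _ c]) auto
  qed
qed

lemma borel_measurable_dist_action: "(\<lambda>\<sigma>. d (\<Phi> \<sigma> c) z) \<in> borel_measurable borel"
  unfolding borel_measurable_iff_less
proof
  fix a
  have "open (mball z a)"
    using openin_mball[of z a] by (simp add: metrises)
  moreover have "continuous_on UNIV (\<lambda>\<sigma>. \<Phi> \<sigma> c)"
    using continuous_on_compose2[OF continuous_action
        continuous_on_Pair[OF continuous_on_id continuous_on_const]]
    by simp
  ultimately have "open ((\<lambda>\<sigma>. \<Phi> \<sigma> c) -` mball z a)"
    by (simp add: continuous_on_open_vimage)
  then show "{\<sigma> \<in> space borel. d (\<Phi> \<sigma> c) z < a} \<in> sets borel"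
    by (simp add: vimage_def commute)
qed

text \<open>
  An \<open>M\<close>-valued map is treated as measurable if its distance to every point is. The reason that
  a random group element preserves this is that, by invariance, \<open>d (\<Phi> \<sigma> y) z\<close> is the infimum of
  \<open>d c y + d (\<Phi> \<sigma> c) z\<close> over \<open>c\<close> in a countable dense set, which separates \<open>\<sigma>\<close> from \<open>y\<close>.
\<close>

lemma measurable_dist_action:
  assumes x: "x \<in> A \<rightarrow>\<^sub>M borel"
    and y: "\<And>z. (\<lambda>\<omega>. d (y \<omega>) z) \<in> borel_measurable A"
  shows "(\<lambda>\<omega>. d (\<Phi> (x \<omega>) (y \<omega>)) z) \<in> borel_measurable A"
proof -
  obtain D where D: "countable D" "\<And>x e. e > 0 \<Longrightarrow> \<exists>c\<in>D. d c x < e"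
    using countable_dense by blast
  have infimum: "d (\<Phi> \<sigma> q) z < a \<longleftrightarrow> (\<exists>c\<in>D. d q c + d (\<Phi> \<sigma> c) z < a)" for \<sigma> q a
  proof
    assume "d (\<Phi> \<sigma> q) z < a"
    then obtain c where c: "c \<in> D" "d c q < (a - d (\<Phi> \<sigma> q) z) / 2"
      using D(2)[of "(a - d (\<Phi> \<sigma> q) z) / 2" q] by auto
    have "d (\<Phi> \<sigma> c) z \<le> d c q + d (\<Phi> \<sigma> q) z"
      using triangle[of "\<Phi> \<sigma> c" "\<Phi> \<sigma> q" z] by (simp add: invariant)
    with c show "\<exists>c\<in>D. d q c + d (\<Phi> \<sigma> c) z < a"
      by (intro bexI[of _ c]) (auto simp: commute field_simps)
  next
    assume "\<exists>c\<in>D. d q c + d (\<Phi> \<sigma> c) z < a"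
    then obtain c where "d q c + d (\<Phi> \<sigma> c) z < a"
      by blast
    then show "d (\<Phi> \<sigma> q) z < a"
      using triangle[of "\<Phi> \<sigma> q" "\<Phi> \<sigma> c" z] by (simp add: invariant)
  qed
  have [measurable]: "(\<lambda>\<omega>. d (\<Phi> (x \<omega>) c) z) \<in> borel_measurable A" for c
    using measurable_compose[OF x borel_measurable_dist_action] .
  note y [measurable]
  have "{\<omega> \<in> space A. d (\<Phi> (x \<omega>) (y \<omega>)) z < a} =
      (\<Union>c\<in>D. {\<omega> \<in> space A. d (y \<omega>) c + d (\<Phi> (x \<omega>) c) z < a})" for a
    by (auto simp: infimum)
  moreover have "(\<Union>c\<in>D. {\<omega> \<in> space A. d (y \<omega>) c + d (\<Phi> (x \<omega>) c) z < a}) \<in> sets A" for a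
    using D(1) by (intro sets.countable_UN') auto
  ultimately show ?thesis
    unfolding borel_measurable_iff_less by simp
qed

lemma measurable_dist_iterated_action:
  assumes "\<And>i. (\<lambda>\<omega>. x \<omega> i) \<in> A \<rightarrow>\<^sub>M borel"
  shows "(\<lambda>\<omega>. d (iterated_action \<Phi> p n (x \<omega>)) z) \<in> borel_measurable A"
  using assms
proof (induction n arbitrary: x z)
  case (Suc n)
  have "(\<lambda>\<omega>. d (iterated_action \<Phi> p n (\<lambda>i. x \<omega> (Suc i))) z) \<in> borel_measurable A" for z
    using Suc.prems by (intro Suc.IH)
  then show ?case
    using measurable_dist_action[OF Suc.prems[of 0]] by simp
qed simp

section \<open>Almost sure return\<close>

text \<open>
  The events that the orbit never returns close to its position at time \<open>j * L\<close>, once \<open>L\<close> more time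
  units have passed, are equiprobable. Any two of them that occur separate the positions at
  their respective times, since these times differ by at least \<open>L\<close>.
\<close>

lemma AE_returns_after:
  fixes P :: "'w measure" and Z :: "real \<Rightarrow> 'w \<Rightarrow> 'g"
  assumes levy: "levy_process P Z" and e: "e > 0" and L: "L > 0"
  shows "AE \<omega> in P. \<exists>n\<ge>L. d (iterated_action \<Phi> p n (unit_increments Z 0 \<omega>)) p < e"
proof -
  interpret levy_process P Z
    by (rule levy)
  let ?S = "\<Pi>\<^sub>M i\<in>(UNIV::nat set). (borel :: 'g measure)"
  define W where "W = {x \<in> space ?S. \<forall>n\<ge>L. e \<le> d (iterated_action \<Phi> p n x) p}"
  define R where "R k = unit_increments Z k -` W \<inter> space P" for k
  have [measurable]: "(\<lambda>x. d (iterated_action \<Phi> p n x) p) \<in> borel_measurable ?S" for n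
    by (rule measurable_dist_iterated_action) simp
  have W: "W \<in> sets ?S"
    unfolding W_def by measurable
  have R: "R k \<in> events" for k
    unfolding R_def using measurable_unit_increments W by (rule measurable_sets)
  have R_iff: "\<omega> \<in> R k \<longleftrightarrow> \<omega> \<in> space P \<and>
      (\<forall>n\<ge>L. e \<le> d (\<Phi> (Z (real (k + n)) \<omega>) p) (\<Phi> (Z (real k) \<omega>) p))" for \<omega> k
    unfolding dist_process_eq by (auto simp: R_def W_def space_PiM)
  have prob_R: "prob (R k) = prob (R 0)" for k
  proof -
    have "prob (R k) = measure (distr P ?S (unit_increments Z k)) W" for k
      unfolding R_def by (rule measure_distr[symmetric, OF measurable_unit_increments W])
    then show ?thesis
      using distr_unit_increments_shift[of k] by simp
  qed
  obtain N where N: "\<And>(y :: nat \<Rightarrow> 'm) J. finite J \<Longrightarrow>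
    (\<And>i j. i \<in> J \<Longrightarrow> j \<in> J \<Longrightarrow> i < j \<Longrightarrow> e \<le> d (y j) (y i)) \<Longrightarrow> card J \<le> N"
    using card_separated_bounded[OF e] by blast
  have "prob (R 0) = 0"
  proof (rule prob_zero_if_boundedly_many_occur[of "\<lambda>j. R (j * L)"])
    fix \<omega> and J :: "nat set"
    assume J: "finite J" "\<And>j. j \<in> J \<Longrightarrow> \<omega> \<in> R (j * L)"
    show "card J \<le> N"
    proof (rule N[of J "\<lambda>j. \<Phi> (Z (real (j * L)) \<omega>) p"])
      fix i j assume ij: "i \<in> J" "j \<in> J" "i < j"
      have "(j - i) * L \<ge> L"
        using ij(3) by (simp add: Suc_le_eq)
      moreover have "j * L = i * L + (j - i) * L"
        using ij(3) by (simp add: add_mult_distrib[symmetric])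
      ultimately show "e \<le> d (\<Phi> (Z (real (j * L)) \<omega>) p) (\<Phi> (Z (real (i * L)) \<omega>) p)"
        using J(2)[OF ij(1)] unfolding R_iff by metis
    qed (rule J(1))
  qed (rule R, rule prob_R)
  then have "R 0 \<in> null_sets P"
    using R[of 0] by (simp add: null_sets_def emeasure_eq_measure)
  then show ?thesis
    by (rule AE_I') (auto simp: R_def W_def space_PiM not_less)
qed

end

end

theorem proposition4p1:
  fixes \<Phi> :: "'g::topological_group_add \<Rightarrow> 'm::topological_space \<Rightarrow> 'm"
    and d :: "'m \<Rightarrow> 'm \<Rightarrow> real"
    and m :: 'm
    and P :: "'w measure"
    and Z :: "real \<Rightarrow> 'w \<Rightarrow> 'g"
  assumes "metrically_invariant_transformation_group \<Phi> d"
    and "compact (UNIV :: 'm set)"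
    and "cadlag_levy_process P Z"
  shows "recurrent_at P \<Phi> d Z m"
proof -
  interpret metrically_invariant_transformation_group \<Phi> d
    by (rule assms(1))
  interpret cadlag_levy_process P Z
    by (rule assms(3))
  have "AE \<omega> in P. \<forall>L r. \<exists>n\<ge>Suc L.
      d (iterated_action \<Phi> m n (unit_increments Z 0 \<omega>)) m < 1 / real (Suc r)"
    by (intro AE_all_countable[THEN iffD2] allI AE_returns_after[OF assms(2) levy_process_axioms]) simp_all
  with start show ?thesis
    unfolding recurrent_at_def
  proof eventually_elim
    case (elim \<omega>)
    let ?f = "\<lambda>t. ereal (d (induced_process \<Phi> Z m t \<omega>) m)"
    have return: "\<exists>t\<ge>T. d (induced_process \<Phi> Z m t \<omega>) m < e" if "e > 0" for T e
    proof -
      obtain r where r: "1 / real (Suc r) < e"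
        using nat_approx_posE[OF \<open>e > 0\<close>] by blast
      obtain L where L: "T \<le> real L"
        using real_arch_simple by blast
      obtain n where n: "n \<ge> Suc L"
          "d (iterated_action \<Phi> m n (unit_increments Z 0 \<omega>)) m < 1 / real (Suc r)"
        using elim(2) by blast
      have "d (induced_process \<Phi> Z m (real n) \<omega>) m < e"
        using n(2) r elim(1) action_process_eq_iterated_action[of Z 0 n \<omega> m]
        by (simp add: induced_process_def action_zero)
      then show ?thesis
        using n(1) L by (intro exI[of _ "real n"]) simp
    qed
    show "Liminf at_top ?f = 0"
    proof (rule antisym)
      show "0 \<le> Liminf at_top ?f"
        by (rule Liminf_bounded) simp
      show "Liminf at_top ?f \<le> 0"
      proof (rule ccontr)
        assume "\<not> Liminf at_top ?f \<le> 0"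
        then obtain e where e: "0 < ereal e" "ereal e < Liminf at_top ?f"
          using ereal_dense2[of 0 "Liminf at_top ?f"] by (auto simp: not_le)
        from less_LiminfD[OF e(2)] obtain T where
          "\<And>t. t \<ge> T \<Longrightarrow> e < d (induced_process \<Phi> Z m t \<omega>) m"
          by (auto simp: eventually_at_top_linorder)
        with return[of e T] e(1) show False
          by fastforce
      qed
    qed
  qed
qed

end
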